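(* Let $C\ge169$ be an integer, and let $\check\theta_0=\pi/2$. Consider the polyhedral set $\tilde P^{\check\nu^C}(\check\theta)$ with $\check\nu^C$ and $\check\theta_j$, $j=1,\dots,\check\nu^C$, as defined in the context. Then $$L^3\subseteq\tilde P^{\check\nu^C}(\check\theta)\subseteq\psi(C)L^3 .$$ Moreover, $$\check\nu^C-\nu_{\psi(C)-1}\le1 .$$
   Context: $L^3=\{x\in\mathbb{R}^3:\sqrt{x_1^2+x_2^2}\le x_3\}$, and for $\lambda\ge 1$ the notation $\lambda L^3$ denotes the relaxed cone $\{x\in\mathbb{R}^3:\sqrt{x_1^2+x_2^2}\le\lambda x_3\}$ (not the pointwise scaling of $L^3$). Here $\operatorname{arcsec}:[1,\infty)\to[0,\pi/2)$ is the inverse of $\sec$. For a positive integer $\nu$ and angles $\theta_j\in(0,\pi/2)$ with $\sin(\theta_j)=a_j/c_j$, $\cos(\theta_j)=b_j/c_j$ for positive coprime integers $a_j,b_j,c_j$, $j=1,\dots,\nu$, $\tilde P^\nu(\theta)$ is the set of $x\in\mathbb{R}^3$ for which there exist reals $\xi^j,\eta^j$, $j=0,\dots,\nu$, satisfying - $\xi^0\ge|x_1|$, $\eta^0\ge|x_2|$; - $c_j\xi^j=b_j\xi^{j-1}+a_j\eta^{j-1}$ for $j=1,\dots,\nu$; - $c_j\eta^j\ge|-a_j\xi^{j-1}+b_j\eta^{j-1}|$ for $j=1,\dots,\nu$; - $\xi^\nu\le x_3$ and $b_\nu\eta^\nu\le a_\nu\xi^\nu$. For an integer $C\ge169$ (the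 upper bound on the coefficients): - $\psi(C)=\min\{c/b: a,b,c\in\mathbb{Z},\ a^2+b^2=c^2,\ c\le C,\ a,b,c\ge1\}$. - $\check h_{\check\nu^C}=\lfloor\frac12(1+\sqrt{2C-1})\rfloor$ and $\check\nu^C=2+\lfloor\log_2(\check h_{\check\nu^C}-2)\rfloor$. - $\check h_{j-1}=\lceil(\check h_j+1)/2\rceil$ for $j=\check\nu^C,\check\nu^C-1,\dots,3$. - $(\check a_1,\check b_1,\check c_1)=(120,119,169)$ and $(\check a_j,\check b_j,\check c_j)=(2\check h_j-1,\,2\check h_j^2-2\check h_j,\,2\check h_j^2-2\check h_j+1)$ for $j=2,\dots,\check\nu^C$. - $\check\theta_j=\operatorname{arcsec}(\check c_j/\check b_j)$ for $j=1,\dots,\check\nu^C$, with corresponding integers $(a_j,b_j,c_j)=(\check a_j,\check b_j,\check c_j)$ in $\tilde P^{\check\nu^C}(\check\theta)$. For $\delta>0$, $\nu_\delta=\lceil\log_2\frac{\pi}{2\operatorname{arcsec}(1+\delta)}\rceil$. *)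

theory Defs
  imports "HOL-Analysis.Analysis"
begin

definition L3 :: "(real^3) set" where
  "L3 = {x. sqrt ((x$1)\<^sup>2 + (x$2)\<^sup>2) \<le> x$3}"

text \<open>The relaxed cone written \<open>\<lambda> L\<^sup>3\<close>; it is not the pointwise scaling of \<open>L\<^sup>3\<close>.\<close>

definition relaxed_L3 :: "real \<Rightarrow> (real^3) set" where
  "relaxed_L3 l = {x. sqrt ((x$1)\<^sup>2 + (x$2)\<^sup>2) \<le> l * x$3}"

definition sec :: "real \<Rightarrow> real" where
  "sec t = 1 / cos t"

definition arcsec :: "real \<Rightarrow> real" where
  "arcsec = the_inv_into {0..<pi/2} sec"

definition pythagorean_angle :: "real \<Rightarrow> int \<Rightarrow> int \<Rightarrow> int \<Rightarrow> bool" where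
  "pythagorean_angle t a b c \<longleftrightarrow>
     0 < t \<and> t < pi/2 \<and> a > 0 \<and> b > 0 \<and> c > 0 \<and> Gcd {a, b, c} = 1 \<and>
     sin t = real_of_int a / real_of_int c \<and> cos t = real_of_int b / real_of_int c"

text \<open>The angles determine the integers (\<open>pythagorean_angle_unique\<close> below), so the existential
  quantifier over \<open>a\<close>, \<open>b\<close>, \<open>c\<close> only names them; the set is empty if some angle
  \<open>\<theta> j\<close> with \<open>1 \<le> j \<le> \<nu>\<close> has no such integers.\<close>

definition P_tilde :: "nat \<Rightarrow> (nat \<Rightarrow> real) \<Rightarrow> (real^3) set" where
  "P_tilde \<nu> \<theta> = {x. \<exists>(a :: nat \<Rightarrow> int) (b :: nat \<Rightarrow> int) (c :: nat \<Rightarrow> int).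
     (\<forall>j\<in>{1..\<nu>}. pythagorean_angle (\<theta> j) (a j) (b j) (c j)) \<and>
     (\<exists>(\<xi> :: nat \<Rightarrow> real) (\<eta> :: nat \<Rightarrow> real).
        \<xi> 0 \<ge> \<bar>x$1\<bar> \<and> \<eta> 0 \<ge> \<bar>x$2\<bar> \<and>
        (\<forall>j\<in>{1..\<nu>}. c j * \<xi> j = b j * \<xi> (j-1) + a j * \<eta> (j-1)) \<and>
        (\<forall>j\<in>{1..\<nu>}. c j * \<eta> j \<ge> \<bar>- a j * \<xi> (j-1) + b j * \<eta> (j-1)\<bar>) \<and>
        \<xi> \<nu> \<le> x$3 \<and> b \<nu> * \<eta> \<nu> \<le> a \<nu> * \<xi> \<nu>)}"

definition psi :: "int \<Rightarrow> real" where
  "psi C = Min {real_of_int c / real_of_int b | a b c :: int.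
     a\<^sup>2 + b\<^sup>2 = c\<^sup>2 \<and> c \<le> C \<and> a \<ge> 1 \<and> b \<ge> 1 \<and> c \<ge> 1}"

definition check_h_top :: "int \<Rightarrow> int" where
  "check_h_top C = \<lfloor>(1 + sqrt (2 * real_of_int C - 1)) / 2\<rfloor>"

definition check_nu :: "int \<Rightarrow> nat" where
  "check_nu C = nat (2 + \<lfloor>log 2 (real_of_int (check_h_top C) - 2)\<rfloor>)"

text \<open>Only the values at \<open>2 \<le> j \<le> check_nu C\<close> are meaningful.\<close>

function check_h :: "int \<Rightarrow> nat \<Rightarrow> int" where
  "check_h C j =
     (if j < check_nu C then \<lceil>(real_of_int (check_h C (Suc j)) + 1) / 2\<rceil> else check_h_top C)"
  by auto
termination by (relation "Wellfounded.measure (\<lambda>(C, j). check_nu C - j)") auto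

declare check_h.simps [simp del]

definition check_a :: "int \<Rightarrow> nat \<Rightarrow> int" where
  "check_a C j = (if j = 1 then 120 else 2 * check_h C j - 1)"

definition check_b :: "int \<Rightarrow> nat \<Rightarrow> int" where
  "check_b C j = (if j = 1 then 119 else 2 * (check_h C j)\<^sup>2 - 2 * check_h C j)"

definition check_c :: "int \<Rightarrow> nat \<Rightarrow> int" where
  "check_c C j = (if j = 1 then 169 else 2 * (check_h C j)\<^sup>2 - 2 * check_h C j + 1)"

definition check_theta :: "int \<Rightarrow> nat \<Rightarrow> real" where
  "check_theta C j =
     (if j = 0 then pi/2 else arcsec (real_of_int (check_c C j) / real_of_int (check_b C j)))"

definition nu_delta :: "real \<Rightarrow> int" where
  "nu_delta \<delta> = \<lceil>log 2 (pi / (2 * arcsec (1 + \<delta>)))\<rceil>"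

lemma inj_on_sec: "inj_on sec {0..<pi/2}"
proof (rule inj_onI)
  fix x y :: real
  assume xy: "x \<in> {0..<pi/2}" "y \<in> {0..<pi/2}" and "sec x = sec y"
  then have "cos x = cos y" by (simp add: sec_def)
  moreover have "0 \<le> x" "x \<le> pi" "0 \<le> y" "y \<le> pi" using xy by auto
  ultimately show "x = y" using cos_inj_pi by blast
qed

lemma arcsec_eqI: "0 \<le> t \<Longrightarrow> t < pi/2 \<Longrightarrow> sec t = y \<Longrightarrow> arcsec y = t"
  unfolding arcsec_def using the_inv_into_f_eq[OF inj_on_sec] by auto

lemma arcsec_arccos:
  assumes "y \<ge> 1" shows "arcsec y = arccos (1/y)"
proof (rule arcsec_eqI)
  have *: "0 < 1/y" "1/y \<le> 1" "- 1 \<le> 1/y" using assms by (auto intro: order_trans[of _ 0])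
  show "0 \<le> arccos (1/y)" using * by (intro arccos_lbound) auto
  show "arccos (1/y) < pi/2" using * arccos_less_mono[of "1/y" 0] by auto
  show "sec (arccos (1/y)) = y" using * assms by (simp add: sec_def cos_arccos)
qed

lemma pythagorean_angle_unique:
  assumes "pythagorean_angle t a b c" "pythagorean_angle t a' b' c'"
  shows "a' = a \<and> b' = b \<and> c' = c"
proof -
  have pos: "a > 0" "b > 0" "c > 0" "a' > 0" "b' > 0" "c' > 0"
    and Gcd: "Gcd {a, b, c} = 1" "Gcd {a', b', c'} = 1"
    using assms unfolding pythagorean_angle_def by blast+
  have g: "gcd a (gcd b c) = 1" "gcd a' (gcd b' c') = 1"
    using Gcd by simp_all
  have "sin t = real_of_int a / c" "sin t = real_of_int a' / c'"
       "cos t = real_of_int b / c" "cos t = real_of_int b' / c'"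
    using assms unfolding pythagorean_angle_def by blast+
  then have "real_of_int a / c = real_of_int a' / c'" "real_of_int b / c = real_of_int b' / c'"
    by (simp_all only:)
  then have "real_of_int a * c' = real_of_int a' * c" "real_of_int b * c' = real_of_int b' * c"
    using pos by (simp_all only: frac_eq_eq of_int_eq_0_iff less_imp_neq[symmetric] not_False_eq_True)
  then have "real_of_int (c' * a) = real_of_int (c * a')"
      "real_of_int (c' * b) = real_of_int (c * b')"
    by (simp_all only: of_int_mult mult.commute)
  then have ac: "c' * a = c * a'" and bc: "c' * b = c * b'"
    by (simp_all only: of_int_eq_iff)
  have "c' = \<bar>c'\<bar> * gcd a (gcd b c)" using g(1) pos by simp
  also have "\<dots> = gcd (c' * a) (\<bar>c'\<bar> * gcd b c)"
    using pos gcd_mult_distrib_int[of c' a "gcd b c"] by simp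
  also have "\<dots> = gcd (c' * a) (gcd (c' * b) (c' * c))"
    by (simp only: gcd_mult_distrib_int)
  also have "\<dots> = gcd (c * a') (gcd (c * b') (c * c'))"
    by (simp only: ac bc mult.commute[of c' c])
  also have "\<dots> = gcd (c * a') (\<bar>c\<bar> * gcd b' c')"
    by (simp only: gcd_mult_distrib_int)
  also have "\<dots> = \<bar>c\<bar> * gcd a' (gcd b' c')"
    using pos gcd_mult_distrib_int[of c a' "gcd b' c'"] by simp
  also have "\<dots> = c" using g(2) pos by simp
  finally have cc: "c' = c" .
  from ac bc have "a' = a" "b' = b"
    using pos unfolding cc by simp_all
  with cc show ?thesis by blast
qed

lemma pythagorean_angle_check:
  assumes "C \<ge> 169" and "j \<ge> 1"
  shows "pythagorean_angle (check_theta C j) (check_a C j) (check_b C j) (check_c C j)"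
proof -
  define a b c where abc: "a = check_a C j" "b = check_b C j" "c = check_c C j"
  have "sqrt (2 * real_of_int C - 1) \<ge> 3"
    using assms by (intro real_le_rsqrt) auto
  then have top: "check_h_top C \<ge> 2" by (simp add: check_h_top_def le_floor_iff)
  have h: "check_h C i \<ge> 2" for i
  proof (induction "check_nu C - i" arbitrary: i)
    case 0
    then show ?case using top by (simp add: check_h.simps[of C i])
  next
    case (Suc n)
    then have "check_h C (Suc i) \<ge> 2" "i < check_nu C" by simp_all
    then show ?case by (simp add: check_h.simps[of C i] le_ceiling_iff)
  qed
  have pos: "a > 0" "b > 0" "c > 0" and pyth: "a\<^sup>2 + b\<^sup>2 = c\<^sup>2" and g: "coprime b c"
  proof -
    consider "j = 1" | "j \<noteq> 1" by blast
    then have "a > 0 \<and> b > 0 \<and> c > 0 \<and> a\<^sup>2 + b\<^sup>2 = c\<^sup>2 \<and> coprime b c"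
    proof cases
      case 1
      have "gcd 119 (169 :: int) = 1" by code_simp
      then have "coprime 119 (169 :: int)" by (simp only: coprime_iff_gcd_eq_1)
      with 1 show ?thesis by (simp add: abc check_a_def check_b_def check_c_def)
    next
      case 2
      define k where "k = check_h C j"
      have k: "k \<ge> 2" using h by (simp add: k_def)
      have v: "a = 2*k - 1" "b = 2*k\<^sup>2 - 2*k" "c = b + 1"
        using 2 by (simp_all add: abc check_a_def check_b_def check_c_def k_def)
      have "k * 1 < k * k" using k by (intro mult_strict_left_mono) auto
      then have "b > 0" by (simp add: v power2_eq_square)
      moreover have "a\<^sup>2 + b\<^sup>2 = c\<^sup>2"
        unfolding v by (simp add: power2_eq_square algebra_simps)
      moreover have "coprime b c" unfolding v(3) by (rule coprime_add_one_right)
      ultimately show ?thesis using k v by simp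
    qed
    then show "a > 0" "b > 0" "c > 0" "a\<^sup>2 + b\<^sup>2 = c\<^sup>2" "coprime b c" by auto
  qed
  have lt: "b < c"
    using pyth pos by (intro power2_less_imp_less[of b c]) (auto simp: pyth[symmetric])
  have th: "check_theta C j = arccos (b / c)"
    using assms(2) pos lt by (simp add: check_theta_def abc[symmetric] arcsec_arccos)
  have q: "0 < b / c" "b / c < (1::real)" using pos lt by simp_all
  then have q': "- 1 \<le> real_of_int b / c" by linarith
  have "real_of_int (a\<^sup>2 + b\<^sup>2) = real_of_int (c\<^sup>2)" by (simp only: pyth)
  then have "1 - (real_of_int b / c)\<^sup>2 = (real_of_int a / c)\<^sup>2"
    using pos by (simp add: field_simps)
  then have "sin (arccos (b / c)) = a / c"
    using q q' pos sin_arccos[of "b / c"] by simp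
  moreover have "cos (arccos (b / c)) = b / c" using q by (intro cos_arccos) auto
  moreover have "0 < arccos (b / c)" "arccos (b / c) < pi/2"
    using q arccos_less_mono[of 1 "b / c"] arccos_less_mono[of "b / c" 0] by auto
  moreover have "Gcd {a, b, c} = 1" using g by simp
  ultimately show ?thesis
    using pos unfolding pythagorean_angle_def th abc[symmetric] by blast
qed

end

theory Submission
  imports Defs
begin

text \<open>In the plane of \<open>(x\<^sub>1, x\<^sub>2)\<close>, the \<open>j\<close>-th step rotates by \<open>-\<theta>\<^sub>j\<close> and folds the lower half plane
  onto the upper one. The norm never decreases along a feasible sequence, which gives the outer
  inclusion with factor \<open>sec \<theta>\<^sub>\<nu>\<close> for any angles. Taking equality everywhere, the polar angle stays
  below \<open>\<theta>\<^sub>j\<close> as long as \<open>\<theta>\<^sub>1 \<ge> \<pi>/4\<close> and \<open>\<theta>\<^sub>j\<^sub>-\<^sub>1 \<le> 2\<theta>\<^sub>j\<close>, which gives the inner inclusion. For the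
  triples at hand, \<open>\<theta>\<^sub>j = 2 arctan (1/(2h\<^sub>j - 1))\<close> and \<open>h\<^sub>j - 2\<close> is \<open>h\<^sub>\<nu> - 2\<close> divided by \<open>2\<^sup>\<nu>\<^sup>-\<^sup>j\<close> and
  rounded down; in particular \<open>h\<^sub>2 = 3\<close> and \<open>\<theta>\<^sub>1 = 2\<theta>\<^sub>2\<close>. Finally \<open>\<psi>(C)\<close> is attained at the triple
  with index \<open>\<nu>\<close>, since triples with \<open>c - b \<ge> 2\<close> and \<open>c \<le> C\<close> cannot do better.\<close>

section \<open>Outer inclusion for arbitrary angles\<close>

lemma pythagorean_angleD:
  assumes "pythagorean_angle t a b c"
  shows "a > 0" "b > 0" "c > 0" "a\<^sup>2 + b\<^sup>2 = c\<^sup>2" "sec t = real_of_int c / real_of_int b"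
proof -
  show pos: "a > 0" "b > 0" "c > 0"
    and "sec t = real_of_int c / real_of_int b"
    using assms by (auto simp: pythagorean_angle_def sec_def)
  have "(real_of_int a / c)\<^sup>2 + (real_of_int b / c)\<^sup>2 = 1"
    using assms sin_cos_squared_add[of t] by (simp add: pythagorean_angle_def)
  then have "(real_of_int a)\<^sup>2 + (real_of_int b)\<^sup>2 = (real_of_int c)\<^sup>2"
    using pos by (simp add: field_simps)
  then have "real_of_int (a\<^sup>2 + b\<^sup>2) = real_of_int (c\<^sup>2)" by simp
  then show "a\<^sup>2 + b\<^sup>2 = c\<^sup>2" by (simp only: of_int_eq_iff)
qed

text \<open>The matrix with rows \<open>(b, a) / c\<close> and \<open>(- a, b) / c\<close> is a
  rotation. The sign of \<open>v\<close> is left free so that the folded coordinate is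
  covered.\<close>

lemma rotation_norm:
  fixes a b c :: int and x y u v :: real
  assumes "a\<^sup>2 + b\<^sup>2 = c\<^sup>2" "c > 0" "c * u = b * x + a * y" "\<bar>c * v\<bar> = \<bar>- a * x + b * y\<bar>"
  shows "u\<^sup>2 + v\<^sup>2 = x\<^sup>2 + y\<^sup>2"
proof -
  have c2: "(real_of_int c)\<^sup>2 = (real_of_int a)\<^sup>2 + (real_of_int b)\<^sup>2"
    using assms(1) by (metis of_int_add of_int_power)
  have v: "(c * v)\<^sup>2 = (- a * x + b * y)\<^sup>2"
    using assms(4) by (metis power2_abs)
  have "(real_of_int c)\<^sup>2 * (u\<^sup>2 + v\<^sup>2) = (c * u)\<^sup>2 + (c * v)\<^sup>2"
    by (simp add: algebra_simps)
  also have "\<dots> = (b * x + a * y)\<^sup>2 + (- a * x + b * y)\<^sup>2"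
    by (simp only: assms(3) v)
  also have "\<dots> = (real_of_int c)\<^sup>2 * (x\<^sup>2 + y\<^sup>2)"
    unfolding c2 by (simp add: power2_eq_square algebra_simps)
  finally show ?thesis using assms(2) by simp
qed

lemma P_tilde_subset_relaxed_L3:
  assumes "\<nu> \<ge> 1"
  shows "P_tilde \<nu> \<theta> \<subseteq> relaxed_L3 (sec (\<theta> \<nu>))"
proof
  fix x assume "x \<in> P_tilde \<nu> \<theta>"
  then obtain a b c :: "nat \<Rightarrow> int" and \<xi> \<eta> :: "nat \<Rightarrow> real" where
    pyth: "\<And>j. j \<in> {1..\<nu>} \<Longrightarrow> pythagorean_angle (\<theta> j) (a j) (b j) (c j)" and
    start: "\<xi> 0 \<ge> \<bar>x$1\<bar>" "\<eta> 0 \<ge> \<bar>x$2\<bar>" and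
    rot: "\<And>j. j \<in> {1..\<nu>} \<Longrightarrow> c j * \<xi> j = b j * \<xi> (j-1) + a j * \<eta> (j-1)" and
    fold: "\<And>j. j \<in> {1..\<nu>} \<Longrightarrow> c j * \<eta> j \<ge> \<bar>- a j * \<xi> (j-1) + b j * \<eta> (j-1)\<bar>" and
    final: "\<xi> \<nu> \<le> x$3" "b \<nu> * \<eta> \<nu> \<le> a \<nu> * \<xi> \<nu>"
    unfolding P_tilde_def by blast
  have norm: "j \<le> \<nu> \<Longrightarrow> (x$1)\<^sup>2 + (x$2)\<^sup>2 \<le> (\<xi> j)\<^sup>2 + (\<eta> j)\<^sup>2" for j
  proof (induction j)
    case 0
    have "(x$1)\<^sup>2 \<le> (\<xi> 0)\<^sup>2" "(x$2)\<^sup>2 \<le> (\<eta> 0)\<^sup>2"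
      using start by (auto simp: abs_le_square_iff[symmetric])
    then show ?case by simp
  next
    case (Suc j)
    then have j: "Suc j \<in> {1..\<nu>}" by simp
    note D = pythagorean_angleD[OF pyth[OF j]]
    \<comment> \<open>The value of \<open>\<eta> (Suc j)\<close> under equality preserves the norm;
      slack in the constraint can only increase it.\<close>
    define v where "v = \<bar>- a (Suc j) * \<xi> j + b (Suc j) * \<eta> j\<bar> / c (Suc j)"
    have "0 \<le> v" "v \<le> \<eta> (Suc j)"
      using D fold[OF j] by (simp_all add: v_def field_simps)
    then have "v\<^sup>2 \<le> (\<eta> (Suc j))\<^sup>2" by (simp add: power_mono)
    moreover have "(\<xi> (Suc j))\<^sup>2 + v\<^sup>2 = (\<xi> j)\<^sup>2 + (\<eta> j)\<^sup>2"
      using D rot[OF j] by (intro rotation_norm[OF D(4,3)]) (simp_all add: v_def)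
    ultimately show ?case using Suc by simp
  qed
  have nu: "\<nu> \<in> {1..\<nu>}" using assms by simp
  note D = pythagorean_angleD[OF pyth[OF nu]]
  \<comment> \<open>The fold constraint gives the sign of \<open>\<eta> \<nu>\<close>, and the final
    constraint then that of \<open>\<xi> \<nu>\<close>; this makes the squarings below
    monotone.\<close>
  have "c \<nu> * \<eta> \<nu> \<ge> 0" using fold[OF nu] by linarith
  then have eta: "\<eta> \<nu> \<ge> 0" using D by (simp add: zero_le_mult_iff)
  have "0 \<le> b \<nu> * \<eta> \<nu>" using eta D by simp
  then have "0 \<le> a \<nu> * \<xi> \<nu>" using final by linarith
  then have xi: "\<xi> \<nu> \<ge> 0" using D by (simp add: zero_le_mult_iff)
  have "(b \<nu> * \<eta> \<nu>)\<^sup>2 \<le> (a \<nu> * \<xi> \<nu>)\<^sup>2"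
    using final(2) eta D by (intro power_mono) auto
  then have "(real_of_int (b \<nu>))\<^sup>2 * ((\<xi> \<nu>)\<^sup>2 + (\<eta> \<nu>)\<^sup>2)
      \<le> ((real_of_int (a \<nu>))\<^sup>2 + (real_of_int (b \<nu>))\<^sup>2) * (\<xi> \<nu>)\<^sup>2"
    by (simp add: power_mult_distrib algebra_simps)
  also have "\<dots> = (c \<nu> * \<xi> \<nu>)\<^sup>2"
    using D(4) by (simp add: power_mult_distrib flip: of_int_power of_int_add)
  finally have "(\<xi> \<nu>)\<^sup>2 + (\<eta> \<nu>)\<^sup>2 \<le> (sec (\<theta> \<nu>) * \<xi> \<nu>)\<^sup>2"
    using D(2) by (simp add: D(5) power_mult_distrib power_divide field_simps)
  also have "\<dots> \<le> (sec (\<theta> \<nu>) * x$3)\<^sup>2"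
    using D final(1) xi by (intro power_mono mult_left_mono) auto
  finally have "(x$1)\<^sup>2 + (x$2)\<^sup>2 \<le> (sec (\<theta> \<nu>) * x$3)\<^sup>2"
    using norm[of \<nu>] by simp
  moreover have "0 \<le> sec (\<theta> \<nu>) * x$3" using D final(1) xi by simp
  ultimately show "x \<in> relaxed_L3 (sec (\<theta> \<nu>))"
    by (simp add: relaxed_L3_def real_le_lsqrt)
qed

section \<open>Inner inclusion under a doubling condition on the angles\<close>

text \<open>The third assumption says \<open>tan \<theta>' \<le> tan (2\<theta>)\<close> when \<open>2\<theta> < \<pi>/2\<close>, where \<open>tan \<theta> = a/b\<close> and
  \<open>tan \<theta>' = a'/b'\<close>; the case \<open>a' = 1\<close>, \<open>b' = 0\<close> stands for \<open>\<theta>' = \<pi>/2\<close>.\<close>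

lemma fold_sector:
  fixes a b a' b' x y :: real
  assumes "0 < a" "0 < b" "(b\<^sup>2 - a\<^sup>2) * a' \<le> 2 * a * b * b'"
    and "0 \<le> a'" "0 \<le> b'" "a' > 0 \<or> b' > 0" and "0 \<le> x" "0 \<le> y" "b' * y \<le> a' * x"
  shows "b * \<bar>- a * x + b * y\<bar> \<le> a * (b * x + a * y)"
proof -
  \<comment> \<open>The polar angle of (x, y) is at most 2\<theta>, which is what the unfolded
    branch needs. If 2\<theta> \<ge> \<pi>/2, the whole quadrant qualifies.\<close>
  have "(b\<^sup>2 - a\<^sup>2) * y \<le> 2 * a * b * x"
  proof (cases "b\<^sup>2 \<le> a\<^sup>2")
    case True
    then have "(b\<^sup>2 - a\<^sup>2) * y \<le> 0" using assms by (simp add: mult_nonpos_nonneg)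
    moreover have "0 \<le> 2 * a * b * x" using assms by simp
    ultimately show ?thesis by linarith
  next
    case False
    have "b' > 0"
    proof (rule ccontr)
      assume "\<not> b' > 0"
      then have "(b\<^sup>2 - a\<^sup>2) * a' \<le> 0" "a' > 0" using assms by auto
      then show False using False by (simp add: mult_le_0_iff)
    qed
    have "(b\<^sup>2 - a\<^sup>2) * (b' * y) \<le> (b\<^sup>2 - a\<^sup>2) * (a' * x)"
      using False assms by (intro mult_left_mono) auto
    also have "\<dots> \<le> 2 * a * b * b' * x"
      using mult_right_mono[OF assms(3,7)] by (simp add: mult.assoc)
    finally have "b' * ((b\<^sup>2 - a\<^sup>2) * y) \<le> b' * (2 * a * b * x)"
      by (simp add: algebra_simps)
    then show ?thesis using \<open>b' > 0\<close> by simp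
  qed
  then have "b * (- a * x + b * y) \<le> a * (b * x + a * y)"
    by (simp add: power2_eq_square algebra_simps)
  \<comment> \<open>The folded branch reduces to (a^2 + b^2) y \<ge> 0.\<close>
  moreover have "0 \<le> a * (a * y) + b * (b * y)" using assms by simp
  then have "b * (- (- a * x + b * y)) \<le> a * (b * x + a * y)"
    by (simp add: algebra_simps)
  ultimately show ?thesis
    by (cases "- a * x + b * y \<ge> 0") simp_all
qed

text \<open>In terms of angles, \<open>first\<close> is \<open>\<theta> 1 \<ge> pi/4\<close> and
  \<open>double\<close> is \<open>\<theta> (j-1) \<le> 2 * \<theta> j\<close>. These let
  \<open>fold_sector\<close> carry the sector bound from each step to the next.\<close>

lemma L3_subset_P_tilde:
  fixes a b c :: "nat \<Rightarrow> int"
  assumes "\<nu> \<ge> 1"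
    and pyth: "\<And>j. j \<in> {1..\<nu>} \<Longrightarrow> pythagorean_angle (\<theta> j) (a j) (b j) (c j)"
    and first: "b 1 \<le> a 1"
    and double: "\<And>j. j \<in> {2..\<nu>} \<Longrightarrow>
      ((b j)\<^sup>2 - (a j)\<^sup>2) * a (j-1) \<le> 2 * a j * b j * b (j-1)"
  shows "L3 \<subseteq> P_tilde \<nu> \<theta>"
proof
  fix x assume x: "x \<in> L3"
  define F :: "nat \<Rightarrow> real \<times> real" where "F = rec_nat (\<bar>x$1\<bar>, \<bar>x$2\<bar>) (\<lambda>j (u :: real, v :: real).
    ((b (Suc j) * u + a (Suc j) * v) / c (Suc j), \<bar>- a (Suc j) * u + b (Suc j) * v\<bar> / c (Suc j)))"
  define \<xi> \<eta> where "\<xi> = (\<lambda>j. fst (F j))" and "\<eta> = (\<lambda>j. snd (F j))"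
  have F0: "\<xi> 0 = \<bar>x$1\<bar>" "\<eta> 0 = \<bar>x$2\<bar>"
    by (simp_all add: \<xi>_def \<eta>_def F_def)
  have FS: "\<xi> (Suc j) = (b (Suc j) * \<xi> j + a (Suc j) * \<eta> j) / c (Suc j)"
    "\<eta> (Suc j) = \<bar>- a (Suc j) * \<xi> j + b (Suc j) * \<eta> j\<bar> / c (Suc j)" for j
    by (simp_all add: \<xi>_def \<eta>_def F_def case_prod_unfold)
  \<comment> \<open>The sector bound starts at \<open>j = 1\<close>, because \<open>a 0\<close> and
    \<open>b 0\<close> are arbitrary; at 0 only the first quadrant is known.\<close>
  have inv: "j \<le> \<nu> \<Longrightarrow> 0 \<le> \<xi> j \<and> 0 \<le> \<eta> j \<and> (\<xi> j)\<^sup>2 + (\<eta> j)\<^sup>2 = (x$1)\<^sup>2 + (x$2)\<^sup>2 \<and>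
      (j \<ge> 1 \<longrightarrow> b j * \<eta> j \<le> a j * \<xi> j)" for j
  proof (induction j)
    case 0
    then show ?case by (simp add: F0)
  next
    case (Suc j)
    then have j: "Suc j \<in> {1..\<nu>}" by simp
    note D = pythagorean_angleD[OF pyth[OF j]]
    have IH: "0 \<le> \<xi> j" "0 \<le> \<eta> j" "(\<xi> j)\<^sup>2 + (\<eta> j)\<^sup>2 = (x$1)\<^sup>2 + (x$2)\<^sup>2"
      "j \<ge> 1 \<Longrightarrow> b j * \<eta> j \<le> a j * \<xi> j" using Suc by auto
    have "(\<xi> (Suc j))\<^sup>2 + (\<eta> (Suc j))\<^sup>2 = (\<xi> j)\<^sup>2 + (\<eta> j)\<^sup>2"
      using D by (intro rotation_norm[OF D(4,3)]) (simp_all add: FS)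
    moreover have "b (Suc j) * \<bar>- a (Suc j) * \<xi> j + b (Suc j) * \<eta> j\<bar>
        \<le> a (Suc j) * (b (Suc j) * \<xi> j + a (Suc j) * \<eta> j)"
    proof (cases "j = 0")
      case True
      have "(real_of_int (b 1))\<^sup>2 \<le> (real_of_int (a 1))\<^sup>2"
        using first D True by (intro power_mono) auto
      then show ?thesis
        using D IH True fold_sector[of "real_of_int (a (Suc j))" "real_of_int (b (Suc j))" 1 0 "\<xi> j" "\<eta> j"]
        by simp
    next
      case False
      then have "j \<in> {1..\<nu>}" using j by auto
      note D' = pythagorean_angleD[OF pyth[OF this]]
      have "((b (Suc j))\<^sup>2 - (a (Suc j))\<^sup>2) * a j \<le> 2 * a (Suc j) * b (Suc j) * b j"
        using double[of "Suc j"] False j by simp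
      then have "real_of_int (((b (Suc j))\<^sup>2 - (a (Suc j))\<^sup>2) * a j)
          \<le> real_of_int (2 * a (Suc j) * b (Suc j) * b j)"
        by (simp only: of_int_le_iff)
      then show ?thesis
        using D D' IH False
          fold_sector[of "real_of_int (a (Suc j))" "real_of_int (b (Suc j))" "real_of_int (a j)"
            "real_of_int (b j)" "\<xi> j" "\<eta> j"]
        by simp
    qed
    ultimately show ?case
      using D IH by (simp add: FS divide_right_mono)
  qed
  have "\<xi> \<nu> \<le> x$3"
  proof -
    have "\<xi> \<nu> \<le> sqrt ((\<xi> \<nu>)\<^sup>2 + (\<eta> \<nu>)\<^sup>2)" by simp
    then show ?thesis using inv[of \<nu>] x by (simp add: L3_def)
  qed
  moreover have "c j * \<xi> j = b j * \<xi> (j-1) + a j * \<eta> (j-1)"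
    "c j * \<eta> j \<ge> \<bar>- a j * \<xi> (j-1) + b j * \<eta> (j-1)\<bar>" if "j \<in> {1..\<nu>}" for j
    using pythagorean_angleD(3)[OF pyth[OF that]] FS[of "j - 1"] that by simp_all
  moreover have "\<xi> 0 \<ge> \<bar>x$1\<bar>" "\<eta> 0 \<ge> \<bar>x$2\<bar>" "b \<nu> * \<eta> \<nu> \<le> a \<nu> * \<xi> \<nu>"
    using F0 inv[of \<nu>] \<open>\<nu> \<ge> 1\<close> by simp_all
  ultimately show "x \<in> P_tilde \<nu> \<theta>"
    unfolding P_tilde_def using pyth by blast
qed

section \<open>Indices of the triples and their number\<close>

text \<open>The triple of index h has hypotenuse 2h(h - 1) + 1, and solving this for h gives the
  expression under the floor. So h is the largest index whose hypotenuse is at most C; the last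
  bound says that h + 1 is too large.\<close>

lemma check_h_top_bounds:
  assumes "C \<ge> 1"
  defines "h \<equiv> check_h_top C"
  shows "h \<ge> 1" "2 * h * (h - 1) + 1 \<le> C" "C \<le> 2 * h * (h + 1)"
proof -
  define s where "s = sqrt (2 * real_of_int C - 1)"
  have s: "s \<ge> 1" "s\<^sup>2 = 2 * C - 1"
    using assms by (auto simp: s_def)
  have h: "2 * real_of_int h - 1 \<le> s" "s < 2 * real_of_int h + 1"
    using of_int_floor_le[of "(1 + s) / 2"] real_of_int_floor_add_one_gt[of "(1 + s) / 2"]
    unfolding h_def check_h_top_def s_def[symmetric] by (simp_all add: field_simps)
  show h1: "h \<ge> 1" unfolding h_def check_h_top_def s_def[symmetric] le_floor_iff using s by simp
  have "(2 * real_of_int h - 1)\<^sup>2 \<le> s\<^sup>2" using h h1 by (intro power_mono) auto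
  then have "real_of_int (2 * h * (h - 1) + 1) \<le> C"
    unfolding s(2) by (simp add: power2_eq_square algebra_simps)
  then show "2 * h * (h - 1) + 1 \<le> C" by (simp only: of_int_le_iff)
  have "s\<^sup>2 < (2 * real_of_int h + 1)\<^sup>2" using h s by (intro power_strict_mono) auto
  then have "real_of_int C < real_of_int (2 * h * (h + 1) + 1)"
    unfolding s(2) by (simp add: power2_eq_square algebra_simps)
  then show "C \<le> 2 * h * (h + 1)" by (simp only: of_int_less_iff)
qed

lemma le_check_h_top:
  assumes "2 * k * (k - 1) + 1 \<le> C" "C \<ge> 1"
  shows "k \<le> check_h_top C"
proof (rule ccontr)
  let ?h = "check_h_top C"
  assume "\<not> k \<le> ?h"
  then have "?h + 1 \<le> k" by simp
  moreover have "?h \<ge> 1" using check_h_top_bounds assms by blast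
  ultimately have "(?h + 1) * ?h \<le> k * (k - 1)" by (intro mult_mono) auto
  moreover have "C \<le> 2 * ?h * (?h + 1)" using check_h_top_bounds assms by blast
  ultimately show False using assms(1) by (simp add: algebra_simps)
qed

lemma check_h_top_ge_9:
  assumes "C \<ge> 169"
  shows "check_h_top C \<ge> 9"
  using assms by (intro le_check_h_top) auto

text \<open>The logarithm in \<open>check_nu\<close> is nonnegative, so \<open>nat\<close> truncates
  nothing and \<open>check_nu C - 2\<close> is its floor.\<close>

lemma check_nu_bounds:
  assumes "C \<ge> 169"
  shows "check_nu C \<ge> 2" "2 ^ (check_nu C - 2) \<le> check_h_top C - 2"
    "check_h_top C - 2 < 2 ^ (check_nu C - 1)"
proof -
  define y where "y = real_of_int (check_h_top C) - 2"
  have y: "y \<ge> 1" using check_h_top_ge_9[OF assms] by (simp add: y_def)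
  define k where "k = nat \<lfloor>log 2 y\<rfloor>"
  have k: "int k = \<lfloor>log 2 y\<rfloor>" using y by (simp add: k_def)
  then have "2 powr of_int (int k) \<le> y \<and> y < 2 powr (of_int (int k) + 1)"
    using y floor_log_eq_powr_iff[of y 2 "int k"] by simp
  then have yk: "2 ^ k \<le> y" "y < 2 ^ (k + 1)"
    by (simp_all add: powr_realpow powr_add)
  have nu: "check_nu C = k + 2"
    unfolding check_nu_def y_def[symmetric] k[symmetric] by simp
  show "check_nu C \<ge> 2" by (simp add: nu)
  have "real_of_int (2 ^ k) \<le> real_of_int (check_h_top C - 2)"
    "real_of_int (check_h_top C - 2) < real_of_int (2 ^ (k + 1))"
    using yk by (simp_all add: y_def)
  then show "2 ^ (check_nu C - 2) \<le> check_h_top C - 2"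
    "check_h_top C - 2 < 2 ^ (check_nu C - 1)"
    unfolding nu of_int_le_iff of_int_less_iff by simp_all
qed

text \<open>Measured from its fixed point 2, the recursion for \<open>check_h\<close> is halving
  with rounding down.\<close>

lemma ceiling_half_add_one:
  "\<lceil>(real_of_int n + 1) / 2\<rceil> = 2 + (n - 2) div 2"
proof (rule ceiling_unique)
  have "2 * (2 + (n - 2) div 2) - 2 < n + 1" "n + 1 \<le> 2 * (2 + (n - 2) div 2)"
    by presburger+
  then have "real_of_int (2 * (2 + (n - 2) div 2) - 2) < real_of_int (n + 1)"
    "real_of_int (n + 1) \<le> real_of_int (2 * (2 + (n - 2) div 2))"
    by (simp_all only: of_int_less_iff of_int_le_iff)
  then show "real_of_int (2 + (n - 2) div 2) - 1 < (real_of_int n + 1) / 2"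
    "(real_of_int n + 1) / 2 \<le> real_of_int (2 + (n - 2) div 2)"
    by simp_all
qed

lemma check_h_eq_div:
  assumes "j \<le> check_nu C"
  shows "check_h C j = 2 + (check_h_top C - 2) div 2 ^ (check_nu C - j)"
  using assms
proof (induction j rule: inc_induct)
  case base
  then show ?case by (simp add: check_h.simps[of C "check_nu C"])
next
  case (step j)
  have "check_h C j = 2 + (check_h C (Suc j) - 2) div 2"
    using step unfolding check_h.simps[of C j] ceiling_half_add_one by simp
  also have "\<dots> = 2 + (check_h_top C - 2) div 2 ^ (check_nu C - Suc j) div 2"
    by (simp add: step.IH)
  also have "\<dots> = 2 + (check_h_top C - 2) div (2 ^ Suc (check_nu C - Suc j))"
    by (simp only: power_Suc2) (simp add: zdiv_zmult2_eq)
  also have "Suc (check_nu C - Suc j) = check_nu C - j" using step by simp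
  finally show ?case .
qed

text \<open>By the choice of \<open>check_nu\<close>, the quotient by
  \<open>2 ^ (check_nu C - 2)\<close> is 1. The second triple is thus (5, 12, 13), whose doubled
  angle belongs to (120, 119, 169).\<close>

lemma check_h_2:
  assumes "C \<ge> 169"
  shows "check_h C 2 = 3"
proof -
  note B = check_nu_bounds[OF assms]
  have "check_nu C - 1 = Suc (check_nu C - 2)" using B(1) by simp
  then have "(check_h_top C - 2) div 2 ^ (check_nu C - 2) = 1"
    using B by (intro int_div_pos_eq[where r = "check_h_top C - 2 - 2 ^ (check_nu C - 2)"]) auto
  then show ?thesis using check_h_eq_div[OF B(1)] by simp
qed

lemma check_h_ge_2:
  assumes "C \<ge> 169" "j \<le> check_nu C"
  shows "check_h C j \<ge> 2"
  using check_h_eq_div[OF assms(2)] check_h_top_ge_9[OF assms(1)]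
  by (simp add: pos_imp_zdiv_nonneg_iff)

section \<open>Doubling condition for the chosen triples\<close>

text \<open>For h > 1, let \<theta> and \<theta>' be the angles of the two triples. The chain is
  \<theta>'/2 = arctan (1/a') \<le> arctan (1/h) \<le> \<theta>, with each comparison written
  through the tangents of the doubled angles and cleared of denominators.\<close>

lemma half_index_double_angle:
  fixes h h' :: int
  assumes "h \<ge> 1" "h \<le> 2 * h' - 1"
  defines "a \<equiv> 2 * h - 1" and "b \<equiv> 2 * h\<^sup>2 - 2 * h"
    and "a' \<equiv> 2 * h' - 1" and "b' \<equiv> 2 * h'\<^sup>2 - 2 * h'"
  shows "(b\<^sup>2 - a\<^sup>2) * a' \<le> 2 * a * b * b'"
proof -
  define k where "k = h - 1"
  have h: "h = k + 1" and k: "k \<ge> 0" using assms by (simp_all add: k_def)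
  \<comment> \<open>This is arctan (1/h) \<le> \<theta>; in k = h - 1 the difference is visibly
    nonnegative.\<close>
  have "a * b * (h\<^sup>2 - 1) - h * (b\<^sup>2 - a\<^sup>2) = 2 * k^3 * (k + 1) + (k + 1) * (2 * k + 1)\<^sup>2"
    unfolding a_def b_def h by algebra
  moreover have "0 \<le> 2 * k^3 * (k + 1) + (k + 1) * (2 * k + 1)\<^sup>2" using k by simp
  ultimately have "h * (b\<^sup>2 - a\<^sup>2) \<le> a * b * (h\<^sup>2 - 1)" by linarith
  then have 1: "h * (b\<^sup>2 - a\<^sup>2) * a' \<le> a * b * (h\<^sup>2 - 1) * a'"
    using assms by (intro mult_right_mono) auto
  \<comment> \<open>This is arctan (1/a') \<le> arctan (1/h); the factor \<open>a' - h\<close> is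
    nonnegative by the bound on \<open>h\<close>.\<close>
  have "2 * h * b' - (h\<^sup>2 - 1) * a' = (a' - h) * (a' * h + 1)"
    unfolding a'_def b'_def by algebra
  moreover have "0 \<le> (a' - h) * (a' * h + 1)" using assms by simp
  ultimately have "(h\<^sup>2 - 1) * a' \<le> 2 * h * b'" by linarith
  moreover have "0 \<le> a * b"
    unfolding a_def b_def h using k by (simp add: power2_eq_square algebra_simps)
  ultimately have "a * b * ((h\<^sup>2 - 1) * a') \<le> a * b * (2 * h * b')" by (rule mult_left_mono)
  with 1 have "h * ((b\<^sup>2 - a\<^sup>2) * a') \<le> h * (2 * a * b * b')"
    by (simp add: algebra_simps)
  then show ?thesis using assms(1) by simp
qed

lemma check_double_angle:
  assumes "C \<ge> 169" "j \<in> {2..check_nu C}"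
  shows "((check_b C j)\<^sup>2 - (check_a C j)\<^sup>2) * check_a C (j-1)
    \<le> 2 * check_a C j * check_b C j * check_b C (j-1)"
proof (cases "j = 2")
  case True
  \<comment> \<open>Equality holds here: (144 - 25) * 120 = 2 * 5 * 12 * 119.\<close>
  then show ?thesis using check_h_2[OF assms(1)] by (simp add: check_a_def check_b_def)
next
  case False
  then have j: "j \<noteq> 1" "j - 1 \<noteq> 1" "j - 1 < check_nu C" "Suc (j - 1) = j" using assms by auto
  have "check_h C (j - 1) = \<lceil>(real_of_int (check_h C j) + 1) / 2\<rceil>"
    using j check_h.simps[of C "j - 1"] by simp
  then have "check_h C j \<le> 2 * check_h C (j - 1) - 1"
    unfolding ceiling_half_add_one by presburger
  moreover have "check_h C j \<ge> 1" using check_h_ge_2[of C j] assms by simp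
  ultimately have "((2 * (check_h C j)\<^sup>2 - 2 * check_h C j)\<^sup>2 - (2 * check_h C j - 1)\<^sup>2)
      * (2 * check_h C (j - 1) - 1)
    \<le> 2 * (2 * check_h C j - 1) * (2 * (check_h C j)\<^sup>2 - 2 * check_h C j)
      * (2 * (check_h C (j - 1))\<^sup>2 - 2 * check_h C (j - 1))"
    by (intro half_index_double_angle)
  then show ?thesis
    unfolding check_a_def check_b_def by (simp only: j if_False)
qed

section \<open>The minimum \<open>psi C\<close>\<close>

text \<open>Cleared of denominators, this is c/b \<ge> 1 + 1/(2h(h - 1)). If c = b + 1, the triple
  belongs to the family with some index k \<le> h. If c - b \<ge> 2, then b \<le> C - 2 already
  suffices.\<close>

lemma pythagorean_ratio_ge:
  fixes a b c C :: int
  defines "h \<equiv> check_h_top C"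
  assumes "h \<ge> 3" "C \<ge> 1" and "a\<^sup>2 + b\<^sup>2 = c\<^sup>2" "c \<le> C" "a \<ge> 1" "b \<ge> 1" "c \<ge> 1"
  shows "b \<le> (c - b) * (2 * h * (h - 1))"
proof -
  have "b\<^sup>2 < c\<^sup>2" using assms by (simp flip: \<open>a\<^sup>2 + b\<^sup>2 = c\<^sup>2\<close>)
  then have "b < c" using assms by (simp add: power_less_imp_less_base)
  then consider "c = b + 1" | "c \<ge> b + 2" by linarith
  then show ?thesis
  proof cases
    case 1
    have a2: "a\<^sup>2 = 2 * b + 1" using assms 1 by (simp add: power2_eq_square algebra_simps)
    then have "odd (a\<^sup>2)" by simp
    then have "odd a" by simp
    then obtain m where "a = 2 * m + 1" by (rule oddE)
    define k where "k = m + 1"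
    have a: "a = 2 * k - 1" by (simp add: k_def \<open>a = 2 * m + 1\<close>)
    have b: "b = 2 * k * (k - 1)" using a2 unfolding a
      by (simp add: power2_eq_square algebra_simps)
    have "k \<le> h" unfolding h_def using assms 1 b by (intro le_check_h_top) auto
    then have "k * (k - 1) \<le> h * (h - 1)"
      using a assms by (intro mult_mono) auto
    then show ?thesis by (simp add: 1 b)
  next
    case 2
    have "C \<le> 2 * h * (h + 1)" unfolding h_def using check_h_top_bounds assms by blast
    \<comment> \<open>For h \<ge> 3 this gives 2h(h + 1) - 2 \<le> 4h(h - 1).\<close>
    moreover have "3 * h \<le> h * h" using assms by (intro mult_right_mono) auto
    moreover have "b + 2 \<le> C" using assms 2 by simp
    ultimately have "b \<le> 2 * (2 * h * (h - 1))"
      by (simp add: algebra_simps)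
    also have "\<dots> \<le> (c - b) * (2 * h * (h - 1))"
      using 2 assms by (intro mult_right_mono) auto
    finally show ?thesis .
  qed
qed

lemma psi_eq:
  fixes C :: int
  assumes "C \<ge> 169"
  defines "h \<equiv> check_h_top C"
  shows "psi C = real_of_int (2 * h * (h - 1) + 1) / real_of_int (2 * h * (h - 1))"
  unfolding psi_def
proof (rule Min_eqI)
  let ?S = "{real_of_int c / real_of_int b | a b c :: int.
     a\<^sup>2 + b\<^sup>2 = c\<^sup>2 \<and> c \<le> C \<and> a \<ge> 1 \<and> b \<ge> 1 \<and> c \<ge> 1}"
  have h: "h \<ge> 9" unfolding h_def using check_h_top_ge_9[OF assms(1)] .
  have B: "2 * h * (h - 1) > 0" using h by simp
  \<comment> \<open>\<open>Min\<close> needs a finite set; the ratio depends only on b and c, both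
    between 1 and C.\<close>
  have "?S \<subseteq> (\<lambda>(b, c). real_of_int c / real_of_int b) ` ({1..C} \<times> {1..C})"
  proof
    fix y assume "y \<in> ?S"
    then obtain a b c :: int where abc: "y = real_of_int c / real_of_int b" "a\<^sup>2 + b\<^sup>2 = c\<^sup>2"
      "c \<le> C" "b \<ge> 1" "c \<ge> 1" by blast
    have "b\<^sup>2 \<le> c\<^sup>2" by (simp flip: abc(2))
    then have "b \<le> c" using abc by (simp add: abs_le_square_iff[symmetric])
    then show "y \<in> (\<lambda>(b, c). real_of_int c / real_of_int b) ` ({1..C} \<times> {1..C})"
      using abc by (intro image_eqI[of _ _ "(b, c)"]) auto
  qed
  then show "finite ?S" by (rule finite_subset) simp
  have "2 * h * (h - 1) + 1 \<le> C"
    unfolding h_def using check_h_top_bounds assms(1) by simp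
  moreover have "(2 * h - 1)\<^sup>2 + (2 * h * (h - 1))\<^sup>2 = (2 * h * (h - 1) + 1)\<^sup>2"
    by algebra
  moreover have "2 * h - 1 \<ge> 1" "2 * h * (h - 1) \<ge> 1" "2 * h * (h - 1) + 1 \<ge> 1"
    using B h by linarith+
  ultimately show "real_of_int (2 * h * (h - 1) + 1) / real_of_int (2 * h * (h - 1)) \<in> ?S"
    by blast
  show "real_of_int (2 * h * (h - 1) + 1) / real_of_int (2 * h * (h - 1)) \<le> y" if "y \<in> ?S" for y
  proof -
    from that obtain a b c :: int where abc: "y = real_of_int c / real_of_int b"
      "a\<^sup>2 + b\<^sup>2 = c\<^sup>2" "c \<le> C" "a \<ge> 1" "b \<ge> 1" "c \<ge> 1" by blast
    have "b \<le> (c - b) * (2 * h * (h - 1))"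
      unfolding h_def using abc h assms by (intro pythagorean_ratio_ge) auto
    then have "(2 * h * (h - 1) + 1) * b \<le> c * (2 * h * (h - 1))"
      by (simp add: algebra_simps)
    then have "real_of_int ((2 * h * (h - 1) + 1) * b) \<le> real_of_int (c * (2 * h * (h - 1)))"
      by (simp only: of_int_le_iff)
    then have "real_of_int (2 * h * (h - 1) + 1) * b \<le> c * real_of_int (2 * h * (h - 1))"
      by (simp only: of_int_mult)
    moreover have "0 < real_of_int (2 * h * (h - 1))" "0 < real_of_int b"
      using B abc by (simp_all only: of_int_0_less_iff)
    ultimately show ?thesis unfolding abc(1)
      by (simp only: divide_le_eq pos_le_divide_eq) (simp add: field_simps)
  qed
qed

lemma sec_check_theta_check_nu:
  assumes "C \<ge> 169"
  shows "sec (check_theta C (check_nu C)) = psi C"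
proof -
  have nu: "check_nu C \<ge> 2" using check_nu_bounds[OF assms] by simp
  then have "check_nu C \<ge> 1" by simp
  note D = pythagorean_angleD(5)[OF pythagorean_angle_check[OF assms this]]
  have "check_h C (check_nu C) = check_h_top C" by (simp add: check_h.simps)
  then show ?thesis
    using nu by (simp add: D psi_eq[OF assms] check_b_def check_c_def power2_eq_square algebra_simps)
qed

section \<open>Comparison with \<open>nu_delta\<close>\<close>

text \<open>The tangent of half the angle is a/(b + c), and c = b + 1 gives b + c = a^2, hence 1/a
  with a = 2h - 1.\<close>

lemma arcsec_consecutive_triple:
  fixes h :: real
  assumes "h > 1"
  shows "arcsec ((2 * h * (h - 1) + 1) / (2 * h * (h - 1))) = 2 * arctan (1 / (2 * h - 1))"
proof (rule arcsec_eqI)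
  define t where "t = 1 / (2 * h - 1)"
  have t: "0 < t" "t < 1" using assms by (simp_all add: t_def)
  show "0 \<le> 2 * arctan t" using t by simp
  have "arctan t < arctan 1" using t by (simp only: arctan_less_iff)
  then show "2 * arctan t < pi / 2" by (simp add: arctan_one)
  have "cos (2 * arctan t) = 2 * (cos (arctan t))\<^sup>2 - 1" by (rule cos_double_cos)
  also have "\<dots> = 2 / (1 + t\<^sup>2) - 1"
    by (simp add: cos_arctan power_divide)
  also have "\<dots> = (1 - t\<^sup>2) / (1 + t\<^sup>2)"
    using sum_power2_gt_zero_iff[of 1 t] by (simp add: field_simps)
  finally have "sec (2 * arctan t) = (1 + t\<^sup>2) / (1 - t\<^sup>2)" by (simp add: sec_def)
  also have "\<dots> = ((2 * h - 1)\<^sup>2 + 1) / ((2 * h - 1)\<^sup>2 - 1)"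
  proof -
    have "(2 * h - 1)\<^sup>2 \<noteq> 0" using assms by simp
    moreover have "(1 + t\<^sup>2) * (2 * h - 1)\<^sup>2 = (2 * h - 1)\<^sup>2 + 1"
      "(1 - t\<^sup>2) * (2 * h - 1)\<^sup>2 = (2 * h - 1)\<^sup>2 - 1"
      using assms by (simp_all add: t_def power_divide field_simps)
    ultimately show ?thesis by (metis mult_divide_mult_cancel_right)
  qed
  also have "\<dots> = (2 * (2 * h * (h - 1) + 1)) / (2 * (2 * h * (h - 1)))"
    by (simp add: power2_eq_square algebra_simps)
  also have "\<dots> = (2 * h * (h - 1) + 1) / (2 * h * (h - 1))"
    by (rule mult_divide_mult_cancel_left) simp
  finally show "sec (2 * arctan t) = (2 * h * (h - 1) + 1) / (2 * h * (h - 1))" .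
qed

lemma check_nu_le_nu_delta:
  assumes "C \<ge> 169"
  shows "int (check_nu C) - nu_delta (psi C - 1) \<le> 1"
proof -
  define h where "h = real_of_int (check_h_top C)"
  have h: "h \<ge> 9" using check_h_top_ge_9[OF assms] by (simp add: h_def)
  define t where "t = arctan (1 / (2 * h - 1))"
  have "arcsec (psi C) = 2 * t"
    using arcsec_consecutive_triple[of h] h psi_eq[OF assms] by (simp add: h_def t_def)
  then have nu_delta: "nu_delta (psi C - 1) = \<lceil>log 2 (pi / (4 * t))\<rceil>"
    by (simp add: nu_delta_def)
  have t: "0 < t" "t \<le> 1 / (2 * h - 1)"
    using h arctan_le_self[of "1 / (2 * h - 1)"] by (simp_all add: t_def)
  define m where "m = check_nu C - 2"
  have m: "int (check_nu C) = int m + 2"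
    using check_nu_bounds(1)[OF assms] by (simp add: m_def)
  have "real_of_int (2 ^ m) \<le> real_of_int (check_h_top C - 2)"
    using check_nu_bounds(2)[OF assms] unfolding m_def by (simp only: of_int_le_iff)
  then have "2 ^ m \<le> h - 2" by (simp add: h_def)
  \<comment> \<open>The crude bound \<pi> > 3 is enough, and the strictness matters: a logarithm
    above m = \<nu> - 2 has ceiling at least \<nu> - 1.\<close>
  also have "\<dots> < pi * (2 * h - 1) / 4"
  proof -
    have "3 * (2 * h - 1) \<le> pi * (2 * h - 1)"
      using h pi_gt3 by (intro mult_right_mono) auto
    then show ?thesis using h by simp
  qed
  also have "\<dots> \<le> pi / (4 * t)"
  proof -
    have "t * (2 * h - 1) \<le> 1" using t h by (simp add: field_simps)
    then have "pi * (t * (2 * h - 1)) \<le> pi * 1" by (intro mult_left_mono) auto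
    then show ?thesis using t by (simp add: field_simps)
  qed
  finally have "real m < log 2 (pi / (4 * t))"
    using t by (simp add: less_log_iff powr_realpow)
  then show ?thesis unfolding nu_delta m by linarith
qed

theorem proposition6:
  fixes C :: int
  assumes "C \<ge> 169"
  shows "L3 \<subseteq> P_tilde (check_nu C) (check_theta C) \<and>
    P_tilde (check_nu C) (check_theta C) \<subseteq> relaxed_L3 (psi C) \<and>
    int (check_nu C) - nu_delta (psi C - 1) \<le> 1"
proof (intro conjI)
  have nu: "check_nu C \<ge> 1" using check_nu_bounds(1)[OF assms] by simp
  show "L3 \<subseteq> P_tilde (check_nu C) (check_theta C)"
  proof (rule L3_subset_P_tilde[OF nu])
    show "pythagorean_angle (check_theta C j) (check_a C j) (check_b C j) (check_c C j)"
      if "j \<in> {1..check_nu C}" for j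
      using that by (intro pythagorean_angle_check assms) simp
    show "check_b C 1 \<le> check_a C 1" by (simp add: check_a_def check_b_def)
  qed (rule check_double_angle[OF assms])
  show "P_tilde (check_nu C) (check_theta C) \<subseteq> relaxed_L3 (psi C)"
    using P_tilde_subset_relaxed_L3[OF nu] sec_check_theta_check_nu[OF assms] by metis
  show "int (check_nu C) - nu_delta (psi C - 1) \<le> 1"
    by (rule check_nu_le_nu_delta[OF assms])
qed

end
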